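(* Let $V$ be a vector space over a field $\mathbb F$, and let $(M,+)$ be a unital magma with neutral element $\mathbf 0$ and with the two-sided cancellation property. Let $f:V\to M$ be a non-zero function (i.e. $f\not\equiv\mathbf 0$) and let $g:V\to\mathbb F$. Then $$f(s+g(s)t)=f(s)+f(t)\qquad\text{for all } s,t\in V$$ if and only if $f$ is additive (i.e. $f(s+t)=f(s)+f(t)$ for all $s,t\in V$) and $g\equiv 1$.
   Context: A magma $(M,+)$ is a set $M$ with a binary operation $+:M\times M\to M$ (no associativity or commutativity is assumed). It is unital if there is an element $\mathbf 0\in M$ with $\mathbf a+\mathbf 0=\mathbf 0+\mathbf a=\mathbf a$ for all $\mathbf a\in M$. It has the two-sided cancellation property if $\mathbf a+\mathbf b=\mathbf a+\mathbf c$ implies $\mathbf b=\mathbf c$, and $\mathbf b+\mathbf a=\mathbf c+\mathbf a$ implies $\mathbf b=\mathbf c$, for all $\mathbf a,\mathbf b,\mathbf c\in M$. *)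

theory Defs
  imports Complex_Main
begin

locale unital_magma =
  fixes add :: "'m \<Rightarrow> 'm \<Rightarrow> 'm" (infixl \<open>\<oplus>\<close> 65)
    and neutral :: 'm (\<open>\<zero>\<close>)
  assumes right_neutral: "a \<oplus> \<zero> = a"
    and left_neutral: "\<zero> \<oplus> a = a"

locale cancellative_unital_magma = unital_magma +
  assumes left_cancel: "a \<oplus> b = a \<oplus> c \<Longrightarrow> b = c"
    and right_cancel: "b \<oplus> a = c \<oplus> a \<Longrightarrow> b = c"

end

(* If g s is not 1, then t = s / (1 - g s) is a fixed point of t |-> s + g s t, which forces
   f s = 0 by cancellation; hence g = 1 wherever f does not vanish.  Translating by some u with
   f u nonzero shows that every zero s of f is a period of f, so f is also invariant under
   multiplication by g s.  If g s were not 1, it would follow that f ((g s - 1) w) = 0 for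
   every w, so f would vanish identically. *)
theory Submission
  imports Defs
begin

context
  fixes scale :: "'k::field \<Rightarrow> 'v::ab_group_add \<Rightarrow> 'v" (infixr \<open>*s\<close> 75)
    and add :: "'m \<Rightarrow> 'm \<Rightarrow> 'm" (infixl \<open>\<oplus>\<close> 65)
    and neutral :: 'm (\<open>\<zero>\<close>)
    and f :: "'v \<Rightarrow> 'm"
    and g :: "'v \<Rightarrow> 'k"
  assumes vs: "vector_space scale"
    and magma: "cancellative_unital_magma add \<zero>"
    and eq: "\<And>s t. f (s + g s *s t) = f s \<oplus> f t"
begin

interpretation vector_space scale by (fact vs)
interpretation cancellative_unital_magma add neutral by (fact magma)

lemma f_0: "f 0 = \<zero>"
  using eq[of 0 0] left_cancel[of "f 0" "f 0" \<zero>] by (simp add: right_neutral)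

lemma g_eq_1_if_nonzero:
  assumes "f s \<noteq> \<zero>"
  shows "g s = 1"
proof (rule ccontr)
  assume "g s \<noteq> 1"
  define t where "t = inverse (1 - g s) *s s"
  have "(1 - g s) *s t = s"
    using \<open>g s \<noteq> 1\<close> by (simp add: t_def)
  then have "s + g s *s t = t"
    by (simp add: scale_left_diff_distrib algebra_simps)
  with eq[of s t] have "\<zero> \<oplus> f t = f s \<oplus> f t"
    by (simp add: left_neutral)
  then show False
    using right_cancel assms by metis
qed

lemma f_add_if_nonzero: "f u \<noteq> \<zero> \<Longrightarrow> f (u + t) = f u \<oplus> f t"
  using eq[of u t] by (simp add: g_eq_1_if_nonzero)

text \<open>Because \<open>g\<close> is 1 at both \<open>u\<close> and \<open>v\<close>, the value
  at \<open>v + t = u + (v - u + t)\<close> splits off \<open>f v\<close> in one reading and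
  \<open>f u\<close> in the other; these agree and cancel.\<close>

lemma diff_period_if_equal:
  assumes "f u \<noteq> \<zero>" "f v = f u"
  shows "f (v - u + t) = f t"
proof -
  have "f u \<oplus> f (v - u + t) = f (v + t)"
    using f_add_if_nonzero[of u "v - u + t"] assms by (simp add: algebra_simps)
  also have "\<dots> = f u \<oplus> f t"
    using f_add_if_nonzero[of v t] assms by simp
  finally show ?thesis
    by (rule left_cancel)
qed

lemma g_eq_1:
  assumes u: "f u \<noteq> \<zero>"
  shows "g s = 1"
proof (rule ccontr)
  assume g: "g s \<noteq> 1"
  then have s: "f s = \<zero>"
    using g_eq_1_if_nonzero by blast
  \<comment> \<open>Adding a zero \<open>z\<close> of \<open>f\<close> to \<open>u\<close> leaves
    \<open>f u\<close> unchanged, so \<open>z = (u + z) - u\<close> is a difference of points with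
    equal non-zero value.\<close>
  have period: "f (z + t) = f t" if "f z = \<zero>" for z t
    using diff_period_if_equal[of u "u + z" t] f_add_if_nonzero[of u z] u that
    by (simp add: right_neutral)
  have inv: "f (g s *s t) = f t" for t
    using eq[of s t] period[OF s] by (simp add: s left_neutral)
  have vanish: "f ((g s - 1) *s w) = \<zero>" for w
  proof (cases "f w = \<zero>")
    \<comment> \<open>Here \<open>w\<close> and \<open>g s *s w\<close> share a non-zero value by
      \<open>inv\<close>, so their difference is a period; shift 0 by it.\<close>
    case False
    then show ?thesis
      using diff_period_if_equal[of w "g s *s w" 0] inv[of w] f_0
      by (simp add: scale_left_diff_distrib)
  next
    \<comment> \<open>Now \<open>w\<close> itself is a period, and adding it to
      \<open>(g s - 1) *s w\<close> gives \<open>g s *s w\<close>, where \<open>f\<close> equals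
      \<open>f w\<close>.\<close>
    case True
    then show ?thesis
      using period[of w "(g s - 1) *s w"] inv[of w]
      by (simp add: scale_left_diff_distrib)
  qed
  show False
    \<comment> \<open>This choice of \<open>w\<close> turns \<open>(g s - 1) *s w\<close> into
      \<open>u\<close>.\<close>
    using vanish[of "inverse (g s - 1) *s u"] g u by simp
qed

end

theorem theorem4p1:
  fixes scale :: "'k::field \<Rightarrow> 'v::ab_group_add \<Rightarrow> 'v" (infixr \<open>*s\<close> 75)
    and add :: "'m \<Rightarrow> 'm \<Rightarrow> 'm" (infixl \<open>\<oplus>\<close> 65)
    and neutral :: 'm (\<open>\<zero>\<close>)
    and f :: "'v \<Rightarrow> 'm"
    and g :: "'v \<Rightarrow> 'k"
  assumes "vector_space scale"
    and "cancellative_unital_magma add \<zero>"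
    and "\<exists>s. f s \<noteq> \<zero>"
  shows "(\<forall>s t. f (s + g s *s t) = f s \<oplus> f t) \<longleftrightarrow>
    (\<forall>s t. f (s + t) = f s \<oplus> f t) \<and> (\<forall>s. g s = 1)"
proof -
  interpret vector_space scale by (fact assms(1))
  show ?thesis
  proof
    assume eq: "\<forall>s t. f (s + g s *s t) = f s \<oplus> f t"
    then have "g s = 1" for s
      using g_eq_1[OF assms(1,2), of f g] assms(3) by blast
    with eq show "(\<forall>s t. f (s + t) = f s \<oplus> f t) \<and> (\<forall>s. g s = 1)"
      by simp
  qed simp
qed

end
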